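(* Let $H$ be a real Hilbert space, $K\subset H$ a nonempty closed convex set, and let $f,g:K\times K\to\mathbb{R}$ be monotone, upper hemicontinuous equilibrium bifunctions satisfying the standing assumptions listed in the context. Suppose that $g$ is $\rho$-strongly monotone for some $\rho>0$. Let $\{\lambda_n\}_{n\ge 1}$ and $\{\beta_n\}_{n\ge 1}$ be sequences of positive reals, let $x_0,x_1\in K$, and let $\{x_n\}\subset K$ be a sequence such that for every $n\geq 1$, with $y_n:=x_n+\alpha(x_n-x_{n-1})$, $$\beta_n f(x_{n+1},y)+g(x_{n+1},y)+\frac{1}{\lambda_n}\langle x_{n+1}-y_n,\,y-x_{n+1}\rangle\geq 0\qquad\text{for all } y\in K.$$ Assume that for all $u\in S_f$ and all $p\in N_{S_f}(u)$, $$\sum_{n=1}^{+\infty}\lambda_n\beta_n\left[\mathcal{F}_f\left(u,\frac{2p}{\beta_n}\right)-\sigma_{S_f}\left(\frac{2p}{\beta_n}\right)\right]<+\infty,$$ and that $0\leq\alpha<\frac13$ and $\sum_{n=1}^{\infty}\lambda_n=+\infty$. Then (BEP) has a unique solution $u$, i.e. $S=\{u\}$, and the sequence $\{x_n\}$ converges strongly to $u$.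
   Context: A bifunction $f:K\times K\to\mathbb{R}$ is: monotone if $f(x,y)+f(y,x)\leq 0$ for all $x,y\in K$; $\rho$-strongly monotone ($\rho>0$) if $f(x,y)+f(y,x)\leq-\rho\|x-y\|^2$ for all $x,y\in K$; upper hemicontinuous if $\lim_{t\searrow 0}f(tz+(1-t)x,y)\leq f(x,y)$ for all $x,y,z\in K$; an equilibrium bifunction if for each $x\in K$, $f(x,x)=0$ and $f(x,\cdot)$ is convex and lower semicontinuous on $K$. $S_f:=\{u\in K: f(u,y)\geq 0\ \forall y\in K\}$. The bilevel equilibrium problem (BEP) is: find $\bar x\in S_f$ such that $g(\bar x,y)\geq 0$ for all $y\in S_f$; $S$ denotes its solution set. The Fitzpatrick transform of $f$ is $\mathcal{F}_f:K\times H\to\mathbb{R}\cup\{+\infty\}$, $\mathcal{F}_f(x,u)=\sup_{y\in K}\{\langle u,y\rangle+f(y,x)\}$. For $C\subset H$, $\sigma_C(x^* )=\sup_{y\in C}\langle x^*,y\rangle$ is the support function, and $N_C(x)=\{x^*\in H:\langle x^*,u-x\rangle\leq 0\ \forall u\in C\}$ if $x\in C$ (empty otherwise) is the normal cone. For $u\in K$, $g_u:H\to\mathbb{R}\cup\{+\infty\}$ is $g_u(x)=g(u,x)$ if $x\in K$ and $+\infty$ otherwise; $\partial$ is the convex subdifferential. Standing assumptions: $S\neq\emptyset$; for each $y\in K$, $\partial g_y(y)\neq\emptyset$; $K\cap S_f\neq\emptyset$ and $\mathbb{R}_+(K-S_f)$ is a closed linear subspace of $H$. *)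

theory Defs
  imports "HOL-Analysis.Analysis"
begin

text \<open>A bifunction on \<open>K \<times> K\<close> is modelled by a total function \<open>'a \<Rightarrow> 'a \<Rightarrow> real\<close>; its
  values outside \<open>K \<times> K\<close> are arbitrary and never matter for points of \<open>K\<close>. Extended real values are taken in \<^typ>\<open>ereal\<close>.\<close>

definition monotone_bifun :: "'a set \<Rightarrow> ('a \<Rightarrow> 'a \<Rightarrow> real) \<Rightarrow> bool" where
  "monotone_bifun K f \<longleftrightarrow> (\<forall>x\<in>K. \<forall>y\<in>K. f x y + f y x \<le> 0)"

definition strongly_monotone_bifun ::
    "real \<Rightarrow> 'a::real_normed_vector set \<Rightarrow> ('a \<Rightarrow> 'a \<Rightarrow> real) \<Rightarrow> bool" where
  "strongly_monotone_bifun \<rho> K f \<longleftrightarrow>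
     (\<forall>x\<in>K. \<forall>y\<in>K. f x y + f y x \<le> - \<rho> * (norm (x - y))\<^sup>2)"

text \<open>The limit along \<open>t \<searrow> 0\<close> is read as an upper limit; when the limit exists the two agree.\<close>

definition upper_hemicontinuous ::
    "'a::real_vector set \<Rightarrow> ('a \<Rightarrow> 'a \<Rightarrow> real) \<Rightarrow> bool" where
  "upper_hemicontinuous K f \<longleftrightarrow>
     (\<forall>x\<in>K. \<forall>y\<in>K. \<forall>z\<in>K.
        Limsup (at_right (0::real)) (\<lambda>t. ereal (f (t *\<^sub>R z + (1 - t) *\<^sub>R x) y)) \<le> ereal (f x y))"

definition lsc_on :: "'a::topological_space set \<Rightarrow> ('a \<Rightarrow> real) \<Rightarrow> bool" where
  "lsc_on K h \<longleftrightarrow> (\<forall>y\<in>K. ereal (h y) \<le> Liminf (at y within K) (\<lambda>z. ereal (h z)))"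

definition equilibrium_bifun ::
    "'a::real_normed_vector set \<Rightarrow> ('a \<Rightarrow> 'a \<Rightarrow> real) \<Rightarrow> bool" where
  "equilibrium_bifun K f \<longleftrightarrow> (\<forall>x\<in>K. f x x = 0 \<and> convex_on K (f x) \<and> lsc_on K (f x))"

definition equilibria :: "'a set \<Rightarrow> ('a \<Rightarrow> 'a \<Rightarrow> real) \<Rightarrow> 'a set" where
  "equilibria K f = {u \<in> K. \<forall>y\<in>K. f u y \<ge> 0}"

definition bilevel_equilibria ::
    "'a set \<Rightarrow> ('a \<Rightarrow> 'a \<Rightarrow> real) \<Rightarrow> ('a \<Rightarrow> 'a \<Rightarrow> real) \<Rightarrow> 'a set" where
  "bilevel_equilibria K f g = {x \<in> equilibria K f. \<forall>y\<in>equilibria K f. g x y \<ge> 0}"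

definition fitzpatrick ::
    "'a::real_inner set \<Rightarrow> ('a \<Rightarrow> 'a \<Rightarrow> real) \<Rightarrow> 'a \<Rightarrow> 'a \<Rightarrow> ereal" where
  "fitzpatrick K f x u = (SUP y\<in>K. ereal (u \<bullet> y + f y x))"

definition support_fun :: "'a::real_inner set \<Rightarrow> 'a \<Rightarrow> ereal" where
  "support_fun C v = (SUP y\<in>C. ereal (v \<bullet> y))"

definition normal_cone :: "'a::real_inner set \<Rightarrow> 'a \<Rightarrow> 'a set" where
  "normal_cone C x = (if x \<in> C then {v. \<forall>u\<in>C. v \<bullet> (u - x) \<le> 0} else {})"

definition extend_by_infinity :: "'a set \<Rightarrow> ('a \<Rightarrow> real) \<Rightarrow> 'a \<Rightarrow> ereal" where
  "extend_by_infinity K h x = (if x \<in> K then ereal (h x) else \<infinity>)"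

definition subdifferential :: "('a::real_inner \<Rightarrow> ereal) \<Rightarrow> 'a \<Rightarrow> 'a set" where
  "subdifferential \<phi> x =
     {v. \<bar>\<phi> x\<bar> \<noteq> \<infinity> \<and> (\<forall>z. \<phi> x + ereal (v \<bullet> (z - x)) \<le> \<phi> z)}"

definition cone_diff :: "'a::real_vector set \<Rightarrow> 'a set \<Rightarrow> 'a set" where
  "cone_diff A B = {r *\<^sub>R (a - b) | r a b. 0 \<le> r \<and> a \<in> A \<and> b \<in> B}"

end

theory Submission
  imports Defs
begin

text \<open>
  Strong monotonicity of \<open>g\<close> makes the solution \<open>u\<close> of the bilevel problem unique, so the
  task is to show \<open>\<phi> n = (norm (x n - u))\<^sup>2 \<longlonglongrightarrow> 0\<close>. Write \<open>S\<close> for the equilibria of \<open>f\<close>.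

  The point \<open>u\<close> minimises the convex function \<open>g u\<close> over \<open>S\<close>, with minimal value \<open>0\<close>. The
  qualification condition, that the cone generated by \<open>K - S\<close> is a closed subspace, turns
  the constraint into a multiplier (\<open>Lagrange_multiplier_in_normal_cone\<close>, the
  Attouch-Brezis sum rule when one summand is an indicator function): there is \<open>p\<close>
  normal to \<open>S\<close> at \<open>u\<close> with \<open>g u y \<ge> - p \<bullet> (y - u)\<close> for all \<open>y \<in> K\<close>, and hence, by strong
  monotonicity, \<open>g y u \<le> p \<bullet> (y - u) - \<rho> * (norm (y - u))\<^sup>2\<close>. The Fitzpatrick transform measures
  how far the penalty \<open>f\<close> can fail to pay for the linear term: the summability hypothesis,
  applied to \<open>p / 2\<close>, yields a summable sequence \<open>e\<close> with
  \<open>\<lambda>\<^sub>n \<beta>\<^sub>n f y u \<le> e\<^sub>n - \<lambda>\<^sub>n p \<bullet> (y - u)\<close> on \<open>K\<close> (\<open>summable_fitzpatrick_error\<close>). When the scheme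
  is tested at \<open>u\<close> and the two estimates are added, the terms in \<open>p\<close> cancel.

  What is left is a scalar recursion. For
  \<open>\<Psi> n = \<phi> (n + 1) - \<alpha> * \<phi> n + (1 - \<alpha>) * (norm (x (n + 1) - x n))\<^sup>2\<close> it says that \<open>\<Psi>\<close> decreases up to
  summable errors, and the decrease dominates \<open>\<lambda>\<^sub>n \<phi>\<^sub>n\<^sub>+\<^sub>1\<close> as well as, because \<open>\<alpha> < 1 / 3\<close>, the squared
  steps. Thus \<open>\<Psi>\<close> converges, the steps vanish, \<open>\<phi>\<close> converges, and since
  \<open>\<Sum> \<lambda>\<^sub>n \<phi>\<^sub>n\<^sub>+\<^sub>1 < \<infinity> = \<Sum> \<lambda>\<^sub>n\<close> its limit is \<open>0\<close> (\<open>inertial_energy_tendsto_zero\<close>).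

  For the multiplier, let \<open>h v\<close> be the infimum of \<open>g u y\<close> over \<open>y \<in> K\<close>, \<open>s \<in> S\<close> with
  \<open>y - s = v\<close>. The Baire theorem shows that \<open>h\<close> is bounded above near \<open>0\<close> on the subspace
  generated by \<open>K - S\<close>; by convexity \<open>h\<close> then has a lower bound \<open>h v \<ge> h 0 - L * norm v\<close>, and
  separating \<open>(0, - 1)\<close> from the closed cone generated by the epigraph of \<open>h - h 0\<close> gives \<open>p\<close>.
  Weak compactness enters only in the form that bounded closed convex sets that decrease
  have a common point (\<open>nested_bounded_closed_convex_meet\<close>).
\<close>

section \<open>Bounded closed convex sets in a Hilbert space\<close>

text \<open>
  Points \<open>x n \<in> A n\<close> of almost minimal norm form a Cauchy sequence: the midpoint of \<open>x m\<close> and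
  \<open>x n\<close> lies in an earlier set and so is not much shorter than either of them, and the
  parallelogram law makes \<open>x m - x n\<close> short.
\<close>
lemma nested_bounded_closed_convex_meet:
  fixes A :: "nat \<Rightarrow> 'a::{real_inner, complete_space} set"
  assumes ne: "\<And>n. A n \<noteq> {}" and cl: "\<And>n. closed (A n)" and cv: "\<And>n. convex (A n)"
    and mono: "\<And>m n. m \<le> n \<Longrightarrow> A n \<subseteq> A m" and bdd: "bounded (A 0)"
  shows "(\<Inter>n. A n) \<noteq> {}"
proof -
  obtain b where b: "\<And>x. x \<in> A 0 \<Longrightarrow> norm x \<le> b"
    using bdd unfolding bounded_iff by auto
  define d where "d n = (INF x\<in>A n. (norm x)\<^sup>2)" for n
  have below: "bdd_below ((\<lambda>x. (norm x)\<^sup>2) ` A n)" for n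
    by (intro bdd_belowI2[of _ 0]) auto
  have d_le: "d n \<le> (norm x)\<^sup>2" if "x \<in> A n" for n x
    unfolding d_def using below that by (rule cINF_lower)
  have d_mono: "d m \<le> d n" if "m \<le> n" for m n
    unfolding d_def by (rule cINF_superset_mono) (use ne below mono[OF that] in auto)
  have d_bound: "d n \<le> b\<^sup>2" for n
  proof -
    obtain x where "x \<in> A n" using ne by blast
    with mono[of 0 n] b[of x] have "(norm x)\<^sup>2 \<le> b\<^sup>2" by (intro power_mono) auto
    with d_le[OF \<open>x \<in> A n\<close>] show ?thesis by simp
  qed
  have "incseq d" using d_mono by (simp add: incseq_def)
  then obtain l where l: "d \<longlonglongrightarrow> l" and dl: "\<And>n. d n \<le> l"
    using incseq_convergent[of d "b\<^sup>2"] d_bound by auto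
  have "\<exists>x\<in>A n. (norm x)\<^sup>2 < d n + 1 / real (Suc n)" for n
    using cINF_less_iff[OF ne below, of n "d n + 1 / real (Suc n)"] by (simp add: d_def)
  then obtain x where x: "\<And>n. x n \<in> A n"
    and xd: "\<And>n. (norm (x n))\<^sup>2 < d n + 1 / real (Suc n)" by metis
  have close: "(norm (x m - x n))\<^sup>2 \<le> 4 * (l - d N + 1 / real (Suc N))"
    if "N \<le> m" "N \<le> n" for m n N
  proof -
    have "(1/2) *\<^sub>R x m + (1/2) *\<^sub>R x n \<in> A N"
      using x mono[OF that(1)] mono[OF that(2)] by (intro convexD[OF cv]) auto
    then have "d N \<le> (norm ((1/2) *\<^sub>R (x m + x n)))\<^sup>2"
      using d_le by (simp add: scaleR_right_distrib)
    then have 1: "4 * d N \<le> (norm (x m + x n))\<^sup>2"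
      by (simp add: power_divide)
    have 2: "(norm (x m - x n))\<^sup>2 = 2 * (norm (x m))\<^sup>2 + 2 * (norm (x n))\<^sup>2 - (norm (x m + x n))\<^sup>2"
      by (simp add: power2_norm_eq_inner inner_diff_left inner_diff_right inner_add_left
          inner_add_right inner_commute)
    have "1 / real (Suc m) \<le> 1 / real (Suc N)" "1 / real (Suc n) \<le> 1 / real (Suc N)"
      using that by (auto simp: field_simps)
    with 1 2 xd[of m] xd[of n] dl[of m] dl[of n] show ?thesis by argo
  qed
  have "(\<lambda>N. 4 * (l - d N + 1 / real (Suc N))) \<longlonglongrightarrow> 4 * (l - l + 0)"
    by (intro tendsto_intros l LIMSEQ_Suc[OF lim_1_over_n])
  then have lim0: "(\<lambda>N. 4 * (l - d N + 1 / real (Suc N))) \<longlonglongrightarrow> 0" by simp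
  have "Cauchy x"
  proof (rule metric_CauchyI)
    fix e :: real assume "e > 0"
    then obtain N where N: "4 * (l - d N + 1 / real (Suc N)) < e\<^sup>2"
      using order_tendstoD(2)[OF lim0, of "e\<^sup>2"] by (auto simp: eventually_sequentially)
    have "dist (x m) (x n) < e" if "m \<ge> N" "n \<ge> N" for m n
    proof -
      have "(norm (x m - x n))\<^sup>2 < e\<^sup>2" using close[OF that] N by simp
      then show ?thesis using \<open>e > 0\<close> by (simp add: dist_norm power_less_imp_less_base)
    qed
    then show "\<exists>M. \<forall>m\<ge>M. \<forall>n\<ge>M. dist (x m) (x n) < e" by blast
  qed
  then obtain z where z: "x \<longlonglongrightarrow> z"
    using Cauchy_convergent convergent_def by blast
  have "z \<in> A n" for n
  proof (rule closed_sequentially[OF cl])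
    show "x (k + n) \<in> A n" for k using x mono[of n] by (meson le_add2 subsetD)
    show "(\<lambda>k. x (k + n)) \<longlonglongrightarrow> z" using z by (rule LIMSEQ_ignore_initial_segment)
  qed
  then show ?thesis by blast
qed

text \<open>
  A bounded closed convex set is weakly compact, so its image is weakly compact and therefore
  closed. Here the preimages of shrinking balls around a limit point of the image are
  nested bounded closed convex sets, and a common point is mapped to the limit point.
\<close>
lemma closed_bounded_linear_image_convex:
  fixes A :: "'a::{real_inner, complete_space} set" and T :: "'a \<Rightarrow> 'b::real_normed_vector"
  assumes A: "closed A" "convex A" "bounded A" and T: "bounded_linear T"
  shows "closed (T ` A)"
proof -
  have "v \<in> T ` A" if v: "v \<in> closure (T ` A)" for v
  proof -
    define E where "E n = A \<inter> T -` cball v (1 / real (Suc n))" for n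
    have "(\<Inter>n. E n) \<noteq> {}"
    proof (rule nested_bounded_closed_convex_meet)
      fix n
      obtain w where "w \<in> A" "dist (T w) v < 1 / real (Suc n)"
        using v unfolding closure_approachable by (metis imageE of_nat_0_less_iff zero_less_Suc zero_less_divide_1_iff)
      then show "E n \<noteq> {}" by (auto simp: E_def dist_commute intro!: exI[of _ w])
      show "closed (E n)" unfolding E_def
        by (intro closed_Int A(1) closed_vimage closed_cball)
          (use T in \<open>simp add: linear_continuous_on\<close>)
      show "convex (E n)" unfolding E_def
        using T by (intro convex_Int A(2) convex_linear_vimage)
          (auto simp: bounded_linear.linear)
      show "E n \<subseteq> E m" if "m \<le> n" for m
      proof -
        have "1 / real (Suc n) \<le> 1 / real (Suc m)" using that by (simp add: field_simps)
        then show ?thesis unfolding E_def by auto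
      qed
      show "bounded (E 0)" using A(3) by (auto simp: E_def bounded_Int)
    qed
    then obtain w where w: "\<And>n. w \<in> E n" by blast
    have "dist v (T w) \<le> 1 / real (Suc n)" for n using w[of n] by (simp add: E_def)
    then have "dist v (T w) \<le> 0"
      by (intro LIMSEQ_le_const[OF LIMSEQ_Suc[OF lim_1_over_n]]) auto
    then have "T w = v" by simp
    with w[of 0] show ?thesis by (auto simp: E_def)
  qed
  then show ?thesis using closure_subset_eq by blast
qed

text \<open>
  The point \<open>a\<close> is the nearest point of \<open>C\<close> to \<open>z\<close>. It exists because the parts of \<open>C\<close> in
  balls around \<open>z\<close> whose radii decrease to the distance are nested, and the inequality is
  the first-order condition along the segment from \<open>a\<close> to \<open>c\<close>.
\<close>
lemma closed_convex_variational_projection: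
  fixes C :: "'a::{real_inner, complete_space} set"
  assumes C: "closed C" "convex C" "C \<noteq> {}"
  obtains a where "a \<in> C" "\<And>c. c \<in> C \<Longrightarrow> (a - z) \<bullet> (c - a) \<ge> 0"
proof -
  define E where "E n = C \<inter> cball z (infdist z C + 1 / real (Suc n))" for n
  have "(\<Inter>n. E n) \<noteq> {}"
  proof (rule nested_bounded_closed_convex_meet)
    fix n
    have "\<exists>c\<in>C. dist z c < infdist z C + 1 / real (Suc n)"
      using cINF_less_iff[of C "dist z" "infdist z C + 1 / real (Suc n)"] C(3)
      by (simp add: infdist_def)
    then show "E n \<noteq> {}" by (force simp: E_def)
    show "closed (E n)" "convex (E n)" using C by (auto simp: E_def intro: convex_Int)
    show "E n \<subseteq> E m" if "m \<le> n" for m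
    proof -
      have "1 / real (Suc n) \<le> 1 / real (Suc m)" using that by (simp add: field_simps)
      then show ?thesis unfolding E_def by auto
    qed
    show "bounded (E 0)" by (auto simp: E_def bounded_Int)
  qed
  then obtain a where a: "\<And>n. a \<in> E n" by blast
  then have aC: "a \<in> C" by (auto simp: E_def)
  have "dist z a - infdist z C \<le> 1 / real (Suc n)" for n using a[of n] by (simp add: E_def)
  then have "dist z a - infdist z C \<le> 0"
    by (intro LIMSEQ_le_const[OF LIMSEQ_Suc[OF lim_1_over_n]]) auto
  then have min: "norm (a - z) \<le> norm (c - z)" if "c \<in> C" for c
    using infdist_le[OF that, of z] by (simp add: dist_norm norm_minus_commute)
  have "(a - z) \<bullet> (c - a) \<ge> 0" if c: "c \<in> C" for c
  proof (rule ccontr)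
    assume neg: "\<not> (a - z) \<bullet> (c - a) \<ge> 0"
    have ineq: "0 \<le> 2 * ((a - z) \<bullet> (c - a)) + t * (norm (c - a))\<^sup>2" if t: "0 < t" "t \<le> 1" for t
    proof -
      have "(1 - t) *\<^sub>R a + t *\<^sub>R c \<in> C" using t aC c by (intro convexD[OF C(2)]) auto
      then have "(norm (a - z))\<^sup>2 \<le> (norm ((1 - t) *\<^sub>R a + t *\<^sub>R c - z))\<^sup>2"
        using min by (intro power_mono) auto
      also have "(1 - t) *\<^sub>R a + t *\<^sub>R c - z = (a - z) + t *\<^sub>R (c - a)"
        by (simp add: algebra_simps)
      also have "(norm \<dots>)\<^sup>2 = (norm (a - z))\<^sup>2 + t * (2 * ((a - z) \<bullet> (c - a)) + t * (norm (c - a))\<^sup>2)"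
        unfolding power2_norm_eq_inner
        by (simp add: inner_add_left inner_add_right inner_commute algebra_simps)
      finally show ?thesis using t by (simp add: zero_le_mult_iff)
    qed
    have "((\<lambda>t. 2 * ((a - z) \<bullet> (c - a)) + t * (norm (c - a))\<^sup>2)
        \<longlongrightarrow> 2 * ((a - z) \<bullet> (c - a)) + 0 * (norm (c - a))\<^sup>2) (at_right 0)"
      by (intro tendsto_intros)
    then have "0 \<le> 2 * ((a - z) \<bullet> (c - a)) + 0 * (norm (c - a))\<^sup>2"
      by (rule tendsto_lowerbound)
        (auto simp: eventually_at_right_field intro!: exI[of _ 1] ineq)
    with neg show False by simp
  qed
  with aC show ?thesis using that by blast
qed

text \<open>
  The separating vector is \<open>n = a - z\<close>, where \<open>a\<close> is the projection of \<open>z\<close>: it is orthogonal to \<open>a\<close>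
  since the ray through \<open>a\<close> stays in the cone on both sides of \<open>a\<close>.
\<close>
lemma closed_convex_cone_separation:
  fixes C :: "'a::{real_inner, complete_space} set"
  assumes C: "closed C" "convex C" "cone C" "C \<noteq> {}" and z: "z \<notin> C"
  obtains n where "\<And>c. c \<in> C \<Longrightarrow> n \<bullet> c \<ge> 0" "n \<bullet> z < 0"
proof -
  obtain a where a: "a \<in> C" and var: "\<And>c. c \<in> C \<Longrightarrow> (a - z) \<bullet> (c - a) \<ge> 0"
    using closed_convex_variational_projection[OF C(1,2,4), of z] by blast
  have "0 *\<^sub>R a \<in> C" "2 *\<^sub>R a \<in> C" using a C(3) by (auto simp: cone_def simp del: scaleR_zero_left)
  from var[OF this(1)] var[OF this(2)] have 0: "(a - z) \<bullet> a = 0"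
    by (simp add: scaleR_2 inner_diff_right)
  have "a \<noteq> z" using a z by blast
  then have "0 < (a - z) \<bullet> (a - z)" by simp
  with 0 have "(a - z) \<bullet> z < 0" by (simp add: inner_diff_right)
  moreover have "(a - z) \<bullet> c \<ge> 0" if "c \<in> C" for c
    using var[OF that] 0 by (simp add: inner_diff_right)
  ultimately show ?thesis using that by blast
qed

section \<open>A Lagrange multiplier under the closed subspace condition\<close>

text \<open>
  One \<open>B n\<close> contains a relative ball around some \<open>w\<close> by the Baire category theorem, and some
  \<open>B m\<close> contains \<open>- w\<close>, because \<open>V\<close> is a subspace. Taking midpoints in the larger of the two moves
  the ball to the origin.
\<close>
lemma Baire_convex_exhaustion:
  fixes V :: "'a::{real_normed_vector, complete_space} set" and B :: "nat \<Rightarrow> 'a set"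
  assumes V: "closed V" "subspace V" and B: "\<And>n. closed (B n)" "\<And>n. convex (B n)"
    and mono: "\<And>m n. m \<le> n \<Longrightarrow> B m \<subseteq> B n" and UN: "V = (\<Union>n. B n)"
  obtains n r where "r > 0" "V \<inter> ball 0 r \<subseteq> B n"
proof -
  have "\<exists>n. top_of_set V interior_of B n \<noteq> {}"
  proof (rule ccontr)
    assume "\<not> ?thesis"
    then have "top_of_set V interior_of \<Union>(range B) = {}"
      using V(1) B(1) UN
      by (intro Baire_category_alt)
        (auto intro!: completely_metrizable_space_closedin completely_metrizable_space_euclidean
          closed_subset)
    moreover have "top_of_set V interior_of V = V"
      using interior_of_topspace[of "top_of_set V"] by simp
    moreover have "0 \<in> V" using V(2) by (rule subspace_0)
    ultimately show False using UN by auto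
  qed
  then obtain n w where "w \<in> top_of_set V interior_of B n" by blast
  then obtain U where "openin (top_of_set V) U" "w \<in> U" "U \<subseteq> B n"
    unfolding interior_of_def by blast
  then obtain r where r: "r > 0" "w \<in> V" and sub: "\<And>v. v \<in> V \<Longrightarrow> dist v w < r \<Longrightarrow> v \<in> B n"
    unfolding openin_euclidean_subtopology_iff by blast
  have "- w \<in> V" using V(2) r(2) by (rule subspace_neg)
  then obtain m where m: "- w \<in> B m" using UN by blast
  have "v \<in> B (max n m)" if v: "v \<in> V" "norm v < r / 2" for v
  proof -
    have "w + 2 *\<^sub>R v \<in> V" using V(2) v(1) r(2) by (intro subspace_add subspace_scale)
    then have "w + 2 *\<^sub>R v \<in> B n" using v(2) by (intro sub) (auto simp: dist_norm)
    then have "(1/2) *\<^sub>R (w + 2 *\<^sub>R v) + (1/2) *\<^sub>R (- w) \<in> B (max n m)"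
      using m mono[of n "max n m"] mono[of m "max n m"] by (intro convexD[OF B(2)]) auto
    then show ?thesis by (simp add: scaleR_right_distrib)
  qed
  then have "V \<inter> ball 0 (r / 2) \<subseteq> B (max n m)" by auto
  with r(1) that[of "r / 2"] show ?thesis by simp
qed


lemma lsc_on_closed_sublevel:
  assumes "closed K" "lsc_on K h"
  shows "closed {y \<in> K. h y \<le> c}"
proof -
  have "openin (top_of_set K) {y \<in> K. h y > c}"
  proof (subst openin_subopen, intro ballI)
    fix y assume "y \<in> {y \<in> K. c < h y}"
    then have y: "y \<in> K" "c < h y" by auto
    then have "ereal c < Liminf (at y within K) (\<lambda>z. ereal (h z))"
      using assms(2) unfolding lsc_on_def by (metis ereal_less_eq(3) less_le_trans ereal_less(1) less_ereal.simps(1))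
    then have "\<forall>\<^sub>F z in at y within K. c < h z"
      by (auto dest: less_LiminfD)
    then obtain S where "open S" "y \<in> S" "\<forall>z\<in>S. z \<noteq> y \<longrightarrow> z \<in> K \<longrightarrow> c < h z"
      unfolding eventually_at_topological by blast
    with y show "\<exists>T. openin (top_of_set K) T \<and> y \<in> T \<and> T \<subseteq> {y \<in> K. c < h y}"
      by (intro exI[of _ "K \<inter> S"]) (auto intro: openin_open_Int)
  qed
  then have "closedin (top_of_set K) (K - {y \<in> K. h y > c})" by (intro closedin_diff) auto
  moreover have "K - {y \<in> K. h y > c} = {y \<in> K. h y \<le> c}" by auto
  ultimately show ?thesis using assms(1) closedin_closed_trans by metis
qed

lemma convex_on_convex_sublevel:
  assumes "convex_on K h"
  shows "convex {y \<in> K. h y \<le> c}"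
proof (rule convexI)
  fix y z and s t :: real
  assume *: "y \<in> {y \<in> K. h y \<le> c}" "z \<in> {y \<in> K. h y \<le> c}" "0 \<le> s" "0 \<le> t" "s + t = 1"
  then have "h (s *\<^sub>R y + t *\<^sub>R z) \<le> s * h y + t * h z" "s *\<^sub>R y + t *\<^sub>R z \<in> K"
    using assms unfolding convex_on_def by (auto intro: convexD)
  moreover have "s * h y + t * h z \<le> c"
    using * by (intro convex_bound_le) auto
  ultimately show "s *\<^sub>R y + t *\<^sub>R z \<in> {y \<in> K. h y \<le> c}" by simp
qed

text \<open>
  The infimum of \<open>\<phi> y\<close> over all ways to write \<open>v = y - s\<close> is a convex function of \<open>v\<close> on the subspace
  generated by \<open>K - C\<close>. If it is bounded above on a ball around \<open>0\<close>, then moving from \<open>v\<close>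
  through \<open>0\<close> to the opposite side of the ball bounds it below by a multiple of \<open>norm v\<close>. The
  upper bound comes from exhausting the subspace by the closed convex sets \<open>B N\<close> of multiples
  \<open>N * (y - s)\<close> with \<open>\<phi> y\<close>, \<open>y\<close> and \<open>s\<close> bounded in terms of \<open>N\<close>.
\<close>
lemma linear_minorant_of_perturbation_value:
  fixes K C :: "'a::{real_inner, complete_space} set" and \<phi> :: "'a \<Rightarrow> real"
  assumes K: "closed K" and \<phi>: "convex_on K \<phi>" "lsc_on K \<phi>"
    and C: "closed C" "convex C" and u: "u \<in> K" "u \<in> C"
    and min: "\<And>y. y \<in> K \<Longrightarrow> y \<in> C \<Longrightarrow> \<phi> u \<le> \<phi> y"
    and V: "closed (cone_diff K C)" "subspace (cone_diff K C)"
  obtains L where "\<And>y s. y \<in> K \<Longrightarrow> s \<in> C \<Longrightarrow> \<phi> u - L * norm (y - s) \<le> \<phi> y"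
proof -
  define KN where "KN N = {y \<in> K. \<phi> y \<le> \<phi> u + real N} \<inter> cball u (real N)" for N
  define CN where "CN N = C \<inter> cball u (real N)" for N
  define B where "B N = (\<lambda>z. real N *\<^sub>R (fst z - snd z)) ` (KN N \<times> CN N)" for N
  have KNc: "closed (KN N)" "convex (KN N)" "bounded (KN N)" "u \<in> KN N" for N
    using K \<phi> u unfolding KN_def
    by (auto intro!: closed_Int convex_Int lsc_on_closed_sublevel convex_on_convex_sublevel
        simp: bounded_Int)
  have CNc: "closed (CN N)" "convex (CN N)" "bounded (CN N)" "u \<in> CN N" for N
    using C u unfolding CN_def by (auto intro!: convex_Int simp: bounded_Int)
  have bl: "bounded_linear (\<lambda>z::'a \<times> 'a. real N *\<^sub>R (fst z - snd z))" for N
    by (intro bounded_linear_const_scaleR bounded_linear_sub bounded_linear_fst bounded_linear_snd)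
  \<comment> \<open>Smaller multiples are covered too: the pair \<open>(y, s)\<close> can be contracted towards \<open>(u, u)\<close>,
    which scales \<open>y - s\<close> and stays in the two convex sets.\<close>
  have scaled: "r *\<^sub>R (y - s) \<in> B N" if "0 \<le> r" "r \<le> real N" "y \<in> KN N" "s \<in> CN N" for r y s N
  proof (cases "N = 0")
    case True
    with that show ?thesis using KNc(4)[of 0] CNc(4)[of 0] by (force simp: B_def)
  next
    case False
    define c where "c = r / real N"
    have c: "0 \<le> c" "c \<le> 1" "real N * c = r" using that False by (auto simp: c_def)
    have "(1 - c) *\<^sub>R u + c *\<^sub>R y \<in> KN N" "(1 - c) *\<^sub>R u + c *\<^sub>R s \<in> CN N"
      using c that KNc(2,4) CNc(2,4) by (auto intro!: convexD)
    moreover have "r *\<^sub>R (y - s) = real N *\<^sub>R (((1 - c) *\<^sub>R u + c *\<^sub>R y) - ((1 - c) *\<^sub>R u + c *\<^sub>R s))"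
      using c(3) by (simp add: algebra_simps)
    ultimately show ?thesis unfolding B_def by (intro image_eqI) auto
  qed
  have mono: "B m \<subseteq> B n" if "m \<le> n" for m n
  proof -
    have "KN m \<subseteq> KN n" "CN m \<subseteq> CN n" using that by (auto simp: KN_def CN_def)
    then show ?thesis using scaled[of "real m" n] that by (force simp: B_def)
  qed
  have UN: "cone_diff K C = (\<Union>N. B N)"
  proof
    show "(\<Union>N. B N) \<subseteq> cone_diff K C"
      by (force simp: B_def KN_def CN_def cone_diff_def)
    show "cone_diff K C \<subseteq> (\<Union>N. B N)"
    proof
      fix v assume "v \<in> cone_diff K C"
      then obtain r y s where v: "v = r *\<^sub>R (y - s)" "0 \<le> r" "y \<in> K" "s \<in> C"
        unfolding cone_diff_def by blast
      obtain N where N: "r + \<bar>\<phi> y - \<phi> u\<bar> + dist u y + dist u s \<le> real N"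
        using real_arch_simple by blast
      have "r \<le> real N" "\<phi> y \<le> \<phi> u + real N" "dist u y \<le> real N" "dist u s \<le> real N"
        using N v(2) zero_le_dist[of u y] zero_le_dist[of u s] by linarith+
      with v have "r *\<^sub>R (y - s) \<in> B N" by (intro scaled) (auto simp: KN_def CN_def)
      then show "v \<in> (\<Union>N. B N)" using v(1) by blast
    qed
  qed
  obtain N r where r: "r > 0" and ball: "cone_diff K C \<inter> ball 0 r \<subseteq> B N"
  proof (rule Baire_convex_exhaustion[OF V _ _ mono UN])
    show "closed (B n)" for n unfolding B_def
      using KNc CNc bl by (intro closed_bounded_linear_image_convex closed_Times convex_Times bounded_Times)
    show "convex (B n)" for n unfolding B_def
      using KNc CNc bl by (intro convex_linear_image convex_Times bounded_linear.linear)
  qed auto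
  define L where "L = 2 * (real N)\<^sup>2 / r"
  have "\<phi> u - L * norm (y - s) \<le> \<phi> y" if y: "y \<in> K" and s: "s \<in> C" for y s
  proof (cases "y = s")
    case True
    with min y s show ?thesis by simp
  next
    case False
    \<comment> \<open>The point opposite to \<open>y - s\<close> inside the ball is represented by a pair with controlled
      value; the weight \<open>w\<close> is chosen so that the two differences cancel.\<close>
    define c where "c = r / (2 * norm (y - s))"
    have c: "c > 0" using r False by (simp add: c_def)
    have "y - s \<in> cone_diff K C"
      unfolding cone_diff_def using y s by (force intro: exI[of _ 1])
    then have "(- c) *\<^sub>R (y - s) \<in> cone_diff K C" using V(2) by (intro subspace_scale)
    moreover have "norm ((- c) *\<^sub>R (y - s)) < r" using r False c by (simp add: c_def)
    ultimately have "(- c) *\<^sub>R (y - s) \<in> B N" using ball by auto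
    then obtain y' s' where y': "y' \<in> KN N" and s': "s' \<in> CN N"
      and eq: "(- c) *\<^sub>R (y - s) = real N *\<^sub>R (y' - s')"
      unfolding B_def by auto
    define w where "w = c / (c + real N)"
    have w: "0 \<le> w" "0 \<le> 1 - w" "1 - w = real N / (c + real N)"
      using c by (auto simp: w_def field_simps)
    have "w *\<^sub>R (y - s) + (1 - w) *\<^sub>R (y' - s') = (1 / (c + real N)) *\<^sub>R (c *\<^sub>R (y - s) + real N *\<^sub>R (y' - s'))"
      unfolding w(3) by (simp add: w_def scaleR_right_distrib)
    also have "c *\<^sub>R (y - s) + real N *\<^sub>R (y' - s') = 0" using eq by (metis add.right_inverse scaleR_minus_left)
    finally have same: "w *\<^sub>R y + (1 - w) *\<^sub>R y' = w *\<^sub>R s + (1 - w) *\<^sub>R s'"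
      by (simp add: algebra_simps)
    have "w *\<^sub>R y + (1 - w) *\<^sub>R y' \<in> K"
      using \<phi>(1) y y' w(1,2) by (intro convexD) (auto simp: convex_on_def KN_def)
    moreover have "w *\<^sub>R y + (1 - w) *\<^sub>R y' \<in> C"
      unfolding same using C(2) s s' w(1,2) by (intro convexD) (auto simp: CN_def)
    ultimately have "\<phi> u \<le> \<phi> (w *\<^sub>R y + (1 - w) *\<^sub>R y')" by (rule min)
    also have "\<dots> \<le> w * \<phi> y + (1 - w) * \<phi> y'"
      using \<phi>(1) y y' w(1,2) unfolding convex_on_def KN_def by auto
    also have "\<dots> \<le> w * \<phi> y + (1 - w) * (\<phi> u + real N)"
      using y' w(2) by (intro add_left_mono mult_left_mono) (auto simp: KN_def)
    finally have "0 \<le> w * (\<phi> y - \<phi> u) + (1 - w) * real N" by (simp add: algebra_simps)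
    then have "0 \<le> (w * (\<phi> y - \<phi> u) + (1 - w) * real N) * (c + real N)" using c by simp
    also have "\<dots> = c * (\<phi> y - \<phi> u) + (real N)\<^sup>2"
      using c unfolding w(3) by (simp add: w_def power2_eq_square distrib_right)
    finally have "- (real N)\<^sup>2 / c \<le> \<phi> y - \<phi> u" using c by (simp add: field_simps)
    moreover have "(real N)\<^sup>2 / c = L * norm (y - s)" using r False by (simp add: c_def L_def field_simps)
    ultimately show ?thesis by simp
  qed
  then show ?thesis using that by blast
qed

text \<open>
  The set \<open>A\<close> is the epigraph of the perturbed minimal value, shifted so that its value at \<open>0\<close> is
  \<open>0\<close>. The linear minorant keeps \<open>(0, - 1)\<close> away from the closed cone generated by \<open>A\<close>, so a
  hyperplane separates them, and it cannot be vertical. Its slope is the multiplier: the choice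
  \<open>y = u\<close> shows that it is normal to \<open>C\<close>, and \<open>s = u\<close> gives the inequality on \<open>K\<close>.
\<close>
lemma Lagrange_multiplier_in_normal_cone:
  fixes K C :: "'a::{real_inner, complete_space} set" and \<phi> :: "'a \<Rightarrow> real"
  assumes K: "closed K" and \<phi>: "convex_on K \<phi>" "lsc_on K \<phi>"
    and C: "closed C" "convex C" and u: "u \<in> K" "u \<in> C"
    and min: "\<And>y. y \<in> K \<Longrightarrow> y \<in> C \<Longrightarrow> \<phi> u \<le> \<phi> y"
    and V: "closed (cone_diff K C)" "subspace (cone_diff K C)"
  obtains p where "p \<in> normal_cone C u" "\<And>y. y \<in> K \<Longrightarrow> \<phi> u \<le> \<phi> y + p \<bullet> (y - u)"
proof -
  obtain L where L: "\<And>y s. y \<in> K \<Longrightarrow> s \<in> C \<Longrightarrow> \<phi> u - L * norm (y - s) \<le> \<phi> y"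
    using linear_minorant_of_perturbation_value[OF assms] by blast
  define A where "A = {(y - s, t) | y s t. y \<in> K \<and> s \<in> C \<and> \<phi> y - \<phi> u \<le> t}"
  define G where "G = closure (cone hull A)"
  have A_I: "(y - s, \<phi> y - \<phi> u) \<in> A" if "y \<in> K" "s \<in> C" for y s
    using that by (auto simp: A_def)
  have "convex A"
  proof (rule convexI)
    fix a b and v w :: real
    assume a: "a \<in> A" and b: "b \<in> A" and vw: "0 \<le> v" "0 \<le> w" "v + w = 1"
    obtain y s t where a': "a = (y - s, t)" "y \<in> K" "s \<in> C" "\<phi> y - \<phi> u \<le> t"
      using a by (auto simp: A_def)
    obtain y' s' t' where b': "b = (y' - s', t')" "y' \<in> K" "s' \<in> C" "\<phi> y' - \<phi> u \<le> t'"
      using b by (auto simp: A_def)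
    have "\<phi> (v *\<^sub>R y + w *\<^sub>R y') \<le> v * \<phi> y + w * \<phi> y'"
      using \<phi>(1) a' b' vw unfolding convex_on_def by auto
    also have "\<dots> \<le> v * (t + \<phi> u) + w * (t' + \<phi> u)"
      using a' b' vw by (intro add_mono mult_left_mono) auto
    also have "\<dots> = v * t + w * t' + (v + w) * \<phi> u" by (simp add: algebra_simps)
    finally have 1: "\<phi> (v *\<^sub>R y + w *\<^sub>R y') - \<phi> u \<le> v * t + w * t'" using vw by simp
    have 2: "v *\<^sub>R y + w *\<^sub>R y' \<in> K" "v *\<^sub>R s + w *\<^sub>R s' \<in> C"
      using \<phi>(1) C(2) a' b' vw by (auto intro!: convexD simp: convex_on_def)
    have "v *\<^sub>R a + w *\<^sub>R b = ((v *\<^sub>R y + w *\<^sub>R y') - (v *\<^sub>R s + w *\<^sub>R s'), v * t + w * t')"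
      by (simp add: a' b' algebra_simps)
    with 1 2 show "v *\<^sub>R a + w *\<^sub>R b \<in> A" unfolding A_def by blast
  qed
  then have G: "closed G" "convex G" "cone G"
    unfolding G_def
    by (simp_all only: closed_closure convex_closure[OF convex_cone_hull]
        cone_closure[OF cone_cone_hull])
  have AG: "A \<subseteq> G" unfolding G_def by (rule order_trans[OF hull_subset closure_subset])
  have "G \<noteq> {}" using AG A_I[OF u] by blast
  have "cone hull A \<subseteq> {z. 0 \<le> snd z + L * norm (fst z)}"
  proof
    fix z assume "z \<in> cone hull A"
    then obtain c y s t where z: "z = c *\<^sub>R (y - s, t)" and c: "0 \<le> c"
      and yst: "y \<in> K" "s \<in> C" "\<phi> y - \<phi> u \<le> t"
      unfolding cone_hull_expl A_def by blast
    have "0 \<le> c * (t + L * norm (y - s))" using c L[OF yst(1,2)] yst(3) by simp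
    with c show "z \<in> {z. 0 \<le> snd z + L * norm (fst z)}" by (simp add: z distrib_left mult.left_commute)
  qed
  moreover have "closed {z :: 'a \<times> real. 0 \<le> snd z + L * norm (fst z)}"
    by (intro closed_Collect_le continuous_intros)
  ultimately have "G \<subseteq> {z. 0 \<le> snd z + L * norm (fst z)}"
    unfolding G_def by (rule closure_minimal)
  then have "(0, - 1) \<notin> G" by auto
  then obtain n where n: "\<And>z. z \<in> G \<Longrightarrow> n \<bullet> z \<ge> 0" "n \<bullet> (0, - 1) < 0"
    using closed_convex_cone_separation[OF G \<open>G \<noteq> {}\<close>] by metis
  obtain a b where ab: "n = (a, b)" by (cases n)
  with n(2) have b: "b > 0" by simp
  have ineq: "\<phi> u \<le> \<phi> y + ((1 / b) *\<^sub>R a) \<bullet> (y - s)" if "y \<in> K" "s \<in> C" for y s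
  proof -
    have "0 \<le> a \<bullet> (y - s) + b * (\<phi> y - \<phi> u)"
      using n(1)[of "(y - s, \<phi> y - \<phi> u)"] AG A_I[OF that] by (auto simp: ab)
    then have "0 \<le> (a \<bullet> (y - s) + b * (\<phi> y - \<phi> u)) / b" using b by simp
    then show ?thesis using b by (simp add: add_divide_distrib)
  qed
  have "(1 / b) *\<^sub>R a \<in> normal_cone C u"
  proof -
    have "((1 / b) *\<^sub>R a) \<bullet> (s - u) \<le> 0" if "s \<in> C" for s
      using ineq[OF u(1) that] unfolding inner_diff_right by linarith
    then show ?thesis using u by (simp add: normal_cone_def)
  qed
  then show ?thesis using ineq[OF _ u(2)] that by blast
qed

section \<open>The scalar recursion of an inertial method\<close>
lemma perturbed_contraction_tendsto_zero:
  fixes z \<epsilon> :: "nat \<Rightarrow> real"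
  assumes z: "\<And>n. 0 \<le> z n" and step: "\<And>n. z (Suc n) \<le> \<alpha> * z n + \<epsilon> n"
    and \<alpha>: "0 \<le> \<alpha>" "\<alpha> < 1" and \<epsilon>: "\<epsilon> \<longlonglongrightarrow> 0"
  shows "z \<longlonglongrightarrow> 0"
proof (rule LIMSEQ_I)
  fix e :: real assume e: "e > 0"
  have "\<forall>\<^sub>F n in sequentially. \<epsilon> n < e / 2 * (1 - \<alpha>)"
    using \<epsilon> e \<alpha> by (intro order_tendstoD(2)) auto
  then obtain N where N: "\<And>n. n \<ge> N \<Longrightarrow> \<epsilon> n < e / 2 * (1 - \<alpha>)"
    by (auto simp: eventually_sequentially)
  have bound: "z (k + N) \<le> \<alpha> ^ k * z N + e / 2" for k
  proof (induction k)
    case 0 show ?case using e by simp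
  next
    case (Suc k)
    have "z (Suc k + N) \<le> \<alpha> * z (k + N) + e / 2 * (1 - \<alpha>)"
      using step[of "k + N"] N[of "k + N"] by simp
    also have "\<dots> \<le> \<alpha> * (\<alpha> ^ k * z N + e / 2) + e / 2 * (1 - \<alpha>)"
      using Suc.IH \<alpha> by (intro add_right_mono mult_left_mono)
    also have "\<dots> = \<alpha> ^ Suc k * z N + e / 2" by (simp add: field_simps)
    finally show ?case .
  qed
  have "(\<lambda>k. \<alpha> ^ k * z N) \<longlonglongrightarrow> 0"
    using LIMSEQ_realpow_zero[OF \<alpha>] tendsto_mult_left_zero by blast
  then have "\<forall>\<^sub>F k in sequentially. \<alpha> ^ k * z N < e / 2"
    using e by (intro order_tendstoD(2)) auto
  then obtain M where M: "\<And>k. k \<ge> M \<Longrightarrow> \<alpha> ^ k * z N < e / 2"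
    by (auto simp: eventually_sequentially)
  have "norm (z n - 0) < e" if "n \<ge> M + N" for n
  proof -
    have "M \<le> n - N" "n - N + N = n" using that by auto
    with bound[of "n - N"] M[of "n - N"] z[of n] show ?thesis by simp
  qed
  then show "\<exists>no. \<forall>n\<ge>no. norm (z n - 0) < e" by blast
qed

text \<open>
  The quantity \<open>\<Psi>\<close> is an energy: the step says \<open>\<Psi> (Suc n) + d n \<le> \<Psi> n + e n\<close> with dissipation
  \<open>d n \<ge> 0\<close>. It need not be nonnegative, so boundedness of \<open>\<phi>\<close> has to be derived first, from
  \<open>\<phi> (n + 1) \<le> \<alpha> * \<phi> n + C\<close>. Then the dissipation is summable, \<open>\<Psi>\<close> converges, and so does
  \<open>\<phi> (n + 1) - \<alpha> * \<phi> n\<close>. Since \<open>\<alpha> < 1\<close>, this forces \<open>\<phi>\<close> itself to converge; a positive limit would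
  make \<open>l\<close> summable.
\<close>
lemma inertial_energy_tendsto_zero:
  fixes \<phi> \<delta> e l :: "nat \<Rightarrow> real"
  assumes nn: "\<And>n. 0 \<le> \<phi> n" "\<And>n. 0 \<le> \<delta> n" "\<And>n. 0 \<le> e n" "\<And>n. 0 \<le> l n"
    and e: "summable e" and l: "\<not> summable l"
    and \<alpha>: "0 \<le> \<alpha>" "\<alpha> < 1 / 3" and c: "0 < c"
    and step: "\<And>n. \<phi> (n + 2) - \<alpha> * \<phi> (n + 1) + (1 - \<alpha>) * \<delta> (n + 1) + c * l n * \<phi> (n + 2)
                  \<le> \<phi> (n + 1) - \<alpha> * \<phi> n + 2 * \<alpha> * \<delta> n + e n"
  shows "\<phi> \<longlonglongrightarrow> 0"
proof -
  define \<Psi> where "\<Psi> n = \<phi> (n + 1) - \<alpha> * \<phi> n + (1 - \<alpha>) * \<delta> n" for n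
  define d where "d n = c * l n * \<phi> (n + 2) + (1 - 3 * \<alpha>) * \<delta> n" for n
  have d_nn: "0 \<le> d n" for n using nn \<alpha> c by (simp add: d_def)
  have \<Psi>_step: "\<Psi> (Suc n) + d n \<le> \<Psi> n + e n" for n
    using step[of n] by (simp add: \<Psi>_def d_def algebra_simps)
  have \<Psi>_sum: "\<Psi> n + (\<Sum>k<n. d k) \<le> \<Psi> 0 + (\<Sum>k<n. e k)" for n
  proof (induction n)
    case (Suc n)
    then show ?case using \<Psi>_step[of n] by simp
  qed simp
  define C where "C = \<bar>\<Psi> 0\<bar> + suminf e"
  have C: "0 \<le> C" using suminf_nonneg[OF e] nn by (simp add: C_def)
  have e_le: "(\<Sum>k<n. e k) \<le> suminf e" for n
    using nn by (intro sum_le_suminf e) auto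
  have \<Psi>_C: "\<Psi> n + (\<Sum>k<n. d k) \<le> C" for n
    using \<Psi>_sum[of n] e_le[of n] unfolding C_def by linarith
  \<comment> \<open>\<open>C / (1 - \<alpha>)\<close> is the fixed point of \<open>t \<mapsto> \<alpha> * t + C\<close>.\<close>
  define M where "M = \<phi> 0 + C / (1 - \<alpha>)"
  have M: "C \<le> (1 - \<alpha>) * M" using \<alpha> nn(1)[of 0] by (simp add: M_def distrib_left)
  have \<phi>_M: "\<phi> n \<le> M" for n
  proof (induction n)
    case 0
    show ?case using C \<alpha> by (simp add: M_def)
  next
    case (Suc n)
    have "0 \<le> (1 - \<alpha>) * \<delta> n" "0 \<le> (\<Sum>k<n. d k)" using \<alpha> nn d_nn by (auto intro: sum_nonneg)
    then have "\<phi> (Suc n) \<le> \<alpha> * \<phi> n + C" using \<Psi>_C[of n] by (simp add: \<Psi>_def)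
    also have "\<dots> \<le> \<alpha> * M + (1 - \<alpha>) * M" using Suc M \<alpha> by (intro add_mono mult_left_mono)
    finally show ?case by (simp add: algebra_simps)
  qed
  have \<Psi>_low: "- M \<le> \<Psi> n" for n
  proof -
    have "\<alpha> * \<phi> n \<le> 1 * M" using \<phi>_M[of n] nn \<alpha> by (intro mult_mono) auto
    moreover have "0 \<le> (1 - \<alpha>) * \<delta> n" using \<alpha> nn by simp
    ultimately show ?thesis using nn(1)[of "n + 1"] unfolding \<Psi>_def by linarith
  qed
  have d_sum: "summable d"
  proof (rule bounded_imp_summable)
    show "(\<Sum>k\<le>n. d k) \<le> C + M" for n
      using \<Psi>_C[of "Suc n"] \<Psi>_low[of "Suc n"] by (simp add: lessThan_Suc_atMost)
  qed (rule d_nn)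
  have "summable (\<lambda>n. (1 - 3 * \<alpha>) * \<delta> n)"
    by (rule summable_comparison_test'[OF d_sum, of 0]) (use nn \<alpha> c in \<open>auto simp: d_def\<close>)
  then have "summable \<delta>" using \<alpha> by (simp add: summable_cmult_iff)
  then have \<delta>0: "\<delta> \<longlonglongrightarrow> 0" by (rule summable_LIMSEQ_zero)
  have l\<phi>: "summable (\<lambda>n. c * l n * \<phi> (n + 2))"
    by (rule summable_comparison_test'[OF d_sum, of 0]) (use nn \<alpha> c in \<open>auto simp: d_def\<close>)
  have "decseq (\<lambda>n. \<Psi> n - (\<Sum>k<n. e k))"
  proof (rule decseq_SucI)
    show "\<Psi> (Suc n) - (\<Sum>k<Suc n. e k) \<le> \<Psi> n - (\<Sum>k<n. e k)" for n
      using \<Psi>_step[of n] d_nn[of n] by simp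
  qed
  moreover have "- M - suminf e \<le> \<Psi> n - (\<Sum>k<n. e k)" for n
    using \<Psi>_low[of n] e_le[of n] by linarith
  ultimately obtain m where "(\<lambda>n. \<Psi> n - (\<Sum>k<n. e k)) \<longlonglongrightarrow> m"
    using decseq_convergent by blast
  from tendsto_add[OF this summable_LIMSEQ[OF e]]
  have "\<Psi> \<longlonglongrightarrow> m + suminf e" by simp
  from tendsto_diff[OF this tendsto_mult_right_zero[OF \<delta>0, of "1 - \<alpha>"]]
  have a: "(\<lambda>n. \<phi> (Suc n) - \<alpha> * \<phi> n) \<longlonglongrightarrow> m + suminf e" by (simp add: \<Psi>_def)
  define q where "q = (m + suminf e) / (1 - \<alpha>)"
  have q: "m + suminf e = q - \<alpha> * q"
  proof -
    have "q * (1 - \<alpha>) = m + suminf e" using \<alpha> by (simp add: q_def)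
    then show ?thesis by (simp add: algebra_simps)
  qed
  have "(\<lambda>n. \<bar>\<phi> n - q\<bar>) \<longlonglongrightarrow> 0"
  proof (rule perturbed_contraction_tendsto_zero)
    show "(\<lambda>n. \<bar>\<phi> (Suc n) - \<alpha> * \<phi> n - (q - \<alpha> * q)\<bar>) \<longlonglongrightarrow> 0"
      using tendsto_rabs_zero[OF LIM_zero[OF a[unfolded q]]] .
    show "\<bar>\<phi> (Suc n) - q\<bar> \<le> \<alpha> * \<bar>\<phi> n - q\<bar> + \<bar>\<phi> (Suc n) - \<alpha> * \<phi> n - (q - \<alpha> * q)\<bar>" for n
    proof -
      have "\<bar>\<phi> (Suc n) - q\<bar> = \<bar>\<alpha> * (\<phi> n - q) + (\<phi> (Suc n) - \<alpha> * \<phi> n - (q - \<alpha> * q))\<bar>"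
        by (simp add: algebra_simps)
      also have "\<dots> \<le> \<bar>\<alpha> * (\<phi> n - q)\<bar> + \<bar>\<phi> (Suc n) - \<alpha> * \<phi> n - (q - \<alpha> * q)\<bar>"
        by (rule abs_triangle_ineq)
      finally show ?thesis using \<alpha> by (simp add: abs_mult)
    qed
  qed (use \<alpha> in auto)
  then have \<phi>q: "\<phi> \<longlonglongrightarrow> q" by (simp add: tendsto_rabs_zero_iff LIM_zero_iff)
  have "q = 0"
  proof (rule ccontr)
    assume "q \<noteq> 0"
    moreover have "0 \<le> q" using LIMSEQ_le_const[OF \<phi>q] nn by blast
    ultimately have q0: "0 < q / 2" "q / 2 < q" by auto
    then obtain N where N: "\<And>n. n \<ge> N \<Longrightarrow> q / 2 < \<phi> n"
      using order_tendstoD(1)[OF \<phi>q q0(2)] unfolding eventually_sequentially by blast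
    have "summable (\<lambda>n. c * (q / 2) * l n)"
    proof (rule summable_comparison_test'[OF l\<phi>, of N])
      fix n assume "N \<le> n"
      then have "c * l n * (q / 2) \<le> c * l n * \<phi> (n + 2)"
        using N[of "n + 2"] nn c by (intro mult_left_mono) auto
      then show "norm (c * (q / 2) * l n) \<le> c * l n * \<phi> (n + 2)"
        using nn(4)[of n] c q0 by (simp add: mult.commute mult.left_commute)
    qed
    then have "summable l" using c q0 by (subst (asm) summable_cmult_iff) auto
    with l show False by blast
  qed
  with \<phi>q show ?thesis by simp
qed

section \<open>Equilibria and their normal vectors\<close>

text \<open>
  Minty's lemma. Convexity along the segment from \<open>u\<close> to \<open>y\<close> gives
  \<open>0 = f z z \<le> t * f z y + (1 - t) * f z u\<close> at its points \<open>z\<close>, whence \<open>f z y \<ge> 0\<close>; upper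
  hemicontinuity carries this to \<open>f u y\<close>. The dual description has \<open>u\<close> in the
  argument in which \<open>f\<close> is convex and lower semicontinuous.
\<close>
lemma equilibria_eq_dual_equilibria:
  assumes K: "convex K" and f: "monotone_bifun K f" "upper_hemicontinuous K f" "equilibrium_bifun K f"
  shows "equilibria K f = {u \<in> K. \<forall>y\<in>K. f y u \<le> 0}"
proof (intro equalityI subsetI)
  fix u assume u: "u \<in> equilibria K f"
  have "f y u \<le> 0" if "y \<in> K" for y
  proof -
    have "f u y + f y u \<le> 0" "0 \<le> f u y"
      using f(1) u that by (auto simp: monotone_bifun_def equilibria_def)
    then show ?thesis by linarith
  qed
  with u show "u \<in> {u \<in> K. \<forall>y\<in>K. f y u \<le> 0}" by (auto simp: equilibria_def)
next
  fix u assume "u \<in> {u \<in> K. \<forall>y\<in>K. f y u \<le> 0}"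
  then have u: "u \<in> K" and dual: "\<And>y. y \<in> K \<Longrightarrow> f y u \<le> 0" by auto
  have "0 \<le> f u y" if y: "y \<in> K" for y
  proof -
    have "0 \<le> f (t *\<^sub>R y + (1 - t) *\<^sub>R u) y" if t: "0 < t" "t < 1" for t
    proof -
      define z where "z = t *\<^sub>R y + (1 - t) *\<^sub>R u"
      have z: "z \<in> K" unfolding z_def using K u y t by (intro convexD) auto
      then have "0 = f z z" using f(3) by (simp add: equilibrium_bifun_def)
      also have "\<dots> \<le> t * f z y + (1 - t) * f z u"
        using f(3) z u y t unfolding equilibrium_bifun_def convex_on_def
        by (subst (2) z_def) auto
      also have "(1 - t) * f z u \<le> 0" using dual[OF z] t by (simp add: mult_nonneg_nonpos)
      finally show ?thesis using t unfolding z_def[symmetric] by (simp add: zero_le_mult_iff)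
    qed
    then have "\<forall>\<^sub>F t in at_right 0. ereal 0 \<le> ereal (f (t *\<^sub>R y + (1 - t) *\<^sub>R u) y)"
      by (auto simp: eventually_at_right_field intro!: exI[of _ 1])
    then have "ereal 0 \<le> Liminf (at_right 0) (\<lambda>t. ereal (f (t *\<^sub>R y + (1 - t) *\<^sub>R u) y))"
      by (rule Liminf_bounded)
    also have "\<dots> \<le> Limsup (at_right 0) (\<lambda>t. ereal (f (t *\<^sub>R y + (1 - t) *\<^sub>R u) y))"
      by (rule Liminf_le_Limsup) simp
    also have "\<dots> \<le> ereal (f u y)" using f(2) u y by (auto simp: upper_hemicontinuous_def)
    finally show ?thesis by simp
  qed
  with u show "u \<in> equilibria K f" by (simp add: equilibria_def)
qed

lemma closed_convex_equilibria:
  assumes K: "closed K" "convex K"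
    and f: "monotone_bifun K f" "upper_hemicontinuous K f" "equilibrium_bifun K f"
  shows "closed (equilibria K f)" "convex (equilibria K f)"
proof -
  have eq: "equilibria K f = K \<inter> (\<Inter>y\<in>K. {u \<in> K. f y u \<le> 0})"
    unfolding equilibria_eq_dual_equilibria[OF K(2) f] by auto
  show "closed (equilibria K f)" unfolding eq
    using K f(3) by (intro closed_Int closed_INT ballI lsc_on_closed_sublevel)
      (auto simp: equilibrium_bifun_def)
  show "convex (equilibria K f)" unfolding eq
    using K f(3) by (intro convex_Int convex_INT convex_on_convex_sublevel)
      (auto simp: equilibrium_bifun_def)
qed

lemma support_fun_normal:
  assumes "w \<in> normal_cone C u"
  shows "support_fun C w = ereal (w \<bullet> u)"
proof -
  from assms have "u \<in> C" "\<And>y. y \<in> C \<Longrightarrow> w \<bullet> y \<le> w \<bullet> u"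
    by (auto simp: normal_cone_def inner_diff_right split: if_splits)
  then show ?thesis unfolding support_fun_def by (intro SUP_eqI) auto
qed

text \<open>
  For a normal vector the support function is attained at \<open>u\<close>, so the difference dominates each
  term of the supremum recentred at \<open>u\<close>. It is stated by an inequality of extended reals, which
  covers the case that the transform is infinite.
\<close>
lemma fitzpatrick_gap_ge:
  assumes "w \<in> normal_cone C u" "x \<in> K"
  shows "ereal (w \<bullet> (x - u) + f x u) \<le> fitzpatrick K f u w - support_fun C w"
proof -
  have "ereal (w \<bullet> x + f x u) \<le> fitzpatrick K f u w"
    unfolding fitzpatrick_def using assms(2) by (rule SUP_upper)
  then have "ereal (w \<bullet> x + f x u) - ereal (w \<bullet> u) \<le> fitzpatrick K f u w - ereal (w \<bullet> u)"
    by (rule ereal_minus_mono) simp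
  then show ?thesis unfolding support_fun_normal[OF assms(1)] by (simp add: inner_diff_right algebra_simps)
qed

text \<open>
  The error \<open>e n\<close> is the \<open>n\<close>-th term of the given series. The terms are nonnegative (take \<open>x = u\<close>
  in \<open>fitzpatrick_gap_ge\<close>), which is why the mere upper bound on the sum makes them
  finite and summable. In the scaling \<open>p / bet n\<close> the linear term carries the factor \<open>lam n\<close>
  alone, so that it can later cancel against a multiple of \<open>p\<close> that \<open>bet\<close> does not affect.
\<close>
lemma summable_fitzpatrick_error:
  fixes lam bet :: "nat \<Rightarrow> real"
  assumes f: "equilibrium_bifun K f" and u: "u \<in> K" and p: "p \<in> normal_cone C u"
    and pos: "\<And>n. 0 < lam n" "\<And>n. 0 < bet n"
    and fin: "(\<Sum>n. ereal (lam n * bet n) *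
       (fitzpatrick K f u ((1 / bet n) *\<^sub>R p) - support_fun C ((1 / bet n) *\<^sub>R p))) < \<infinity>"
  obtains e where "summable e" "\<And>n. 0 \<le> e n"
    "\<And>n x. x \<in> K \<Longrightarrow> lam n * bet n * f x u \<le> e n - lam n * (p \<bullet> (x - u))"
proof -
  define T where "T n = ereal (lam n * bet n) *
       (fitzpatrick K f u ((1 / bet n) *\<^sub>R p) - support_fun C ((1 / bet n) *\<^sub>R p))" for n
  have w: "(1 / bet n) *\<^sub>R p \<in> normal_cone C u" for n
    using p pos(2)[of n] by (auto simp: normal_cone_def divide_nonpos_pos split: if_splits)
  have low: "ereal (lam n * (p \<bullet> (x - u)) + lam n * bet n * f x u) \<le> T n" if "x \<in> K" for n x
  proof -
    have "ereal (lam n * bet n) * ereal (((1 / bet n) *\<^sub>R p) \<bullet> (x - u) + f x u) \<le> T n"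
      unfolding T_def using pos[of n]
      by (intro ereal_mult_left_mono fitzpatrick_gap_ge[OF w that]) auto
    moreover have "lam n * bet n * (((1 / bet n) *\<^sub>R p) \<bullet> (x - u) + f x u)
        = lam n * (p \<bullet> (x - u)) + lam n * bet n * f x u"
      using pos(2)[of n] by (simp add: field_simps)
    ultimately show ?thesis by simp
  qed
  have T0: "0 \<le> T n" for n
    using low[OF u, of n] f u by (simp add: equilibrium_bifun_def zero_ereal_def)
  have fin': "suminf T \<noteq> \<infinity>" using fin by (simp add: T_def[abs_def])
  define e where "e n = real_of_ereal (T n)" for n
  have Te: "T n = ereal (e n)" for n
    using T0[of n] suminf_PInfty[OF T0 fin', of n] unfolding e_def by (cases "T n") auto
  show ?thesis
  proof (rule that)
    show "summable e" unfolding e_def by (rule summable_real_of_ereal[OF T0 fin'])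
    show "0 \<le> e n" for n using T0[of n] by (simp add: Te zero_ereal_def)
    show "lam n * bet n * f x u \<le> e n - lam n * (p \<bullet> (x - u))" if "x \<in> K" for n x
      using low[OF that, of n] by (simp add: Te)
  qed
qed

section \<open>Convergence of the inertial proximal scheme\<close>

text \<open>
  With \<open>a\<close>, \<open>b\<close>, \<open>c\<close> three consecutive iterates, the difference of the two sides is
  \<open>\<alpha> * (norm (c - 2 * b + a))\<^sup>2\<close>; the cross term \<open>(b - a) \<bullet> (c - b)\<close> is what is estimated away.
\<close>
lemma inertial_step_energy_inequality:
  fixes a b c u :: "'a::real_inner"
  assumes "0 \<le> \<alpha>"
  shows "(norm (c - u))\<^sup>2 - (norm (b - u))\<^sup>2 - \<alpha> * ((norm (b - u))\<^sup>2 - (norm (a - u))\<^sup>2)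
     + (1 - \<alpha>) * (norm (c - b))\<^sup>2 - 2 * \<alpha> * (norm (b - a))\<^sup>2
     \<le> 2 * ((c - (b + \<alpha> *\<^sub>R (b - a))) \<bullet> (c - u))"
proof -
  have "2 * ((c - (b + \<alpha> *\<^sub>R (b - a))) \<bullet> (c - u))
     - ((norm (c - u))\<^sup>2 - (norm (b - u))\<^sup>2 - \<alpha> * ((norm (b - u))\<^sup>2 - (norm (a - u))\<^sup>2)
     + (1 - \<alpha>) * (norm (c - b))\<^sup>2 - 2 * \<alpha> * (norm (b - a))\<^sup>2)
     = \<alpha> * (norm ((c - b) - (b - a)))\<^sup>2"
    unfolding power2_norm_eq_inner
    by (simp add: inner_diff_left inner_diff_right inner_add_left inner_add_right inner_commute algebra_simps)
  moreover have "0 \<le> \<alpha> * (norm ((c - b) - (b - a)))\<^sup>2" using assms by simp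
  ultimately show ?thesis by linarith
qed

lemma bilevel_equilibria_unique:
  assumes "\<rho> > 0" "strongly_monotone_bifun \<rho> K g"
    and u: "u \<in> bilevel_equilibria K f g" and v: "v \<in> bilevel_equilibria K f g"
  shows "v = u"
proof -
  have "0 \<le> g u v" "0 \<le> g v u" "u \<in> K" "v \<in> K"
    using u v by (auto simp: bilevel_equilibria_def equilibria_def)
  moreover from this assms(2) have "g u v + g v u \<le> - \<rho> * (norm (u - v))\<^sup>2"
    by (simp add: strongly_monotone_bifun_def)
  ultimately have "\<rho> * (norm (u - v))\<^sup>2 \<le> 0" by linarith
  with assms(1) show ?thesis by (simp add: mult_le_0_iff)
qed

theorem theorem2:
  fixes K :: "'a::{real_inner, complete_space} set"
    and f g :: "'a \<Rightarrow> 'a \<Rightarrow> real"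
    and lam bet :: "nat \<Rightarrow> real"
    and \<alpha> \<rho> :: real
    and x :: "nat \<Rightarrow> 'a"
  assumes K: "K \<noteq> {}" "closed K" "convex K"
    and f: "monotone_bifun K f" "upper_hemicontinuous K f" "equilibrium_bifun K f"
    and g: "monotone_bifun K g" "upper_hemicontinuous K g" "equilibrium_bifun K g"
    and S_nonempty: "bilevel_equilibria K f g \<noteq> {}"
    and subdiff: "\<And>y. y \<in> K \<Longrightarrow> subdifferential (extend_by_infinity K (g y)) y \<noteq> {}"
    and qualification: "K \<inter> equilibria K f \<noteq> {}"
      "closed (cone_diff K (equilibria K f))" "subspace (cone_diff K (equilibria K f))"
    and strong: "\<rho> > 0" "strongly_monotone_bifun \<rho> K g"
    and lam_pos: "\<And>n. n \<ge> 1 \<Longrightarrow> lam n > 0"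
    and bet_pos: "\<And>n. n \<ge> 1 \<Longrightarrow> bet n > 0"
    and x_in: "\<And>n. x n \<in> K"
    and scheme: "\<And>n y. n \<ge> 1 \<Longrightarrow> y \<in> K \<Longrightarrow>
      bet n * f (x (n + 1)) y + g (x (n + 1)) y
        + (1 / lam n) * ((x (n + 1) - (x n + \<alpha> *\<^sub>R (x n - x (n - 1)))) \<bullet> (y - x (n + 1))) \<ge> 0"
    and fitz: "\<And>u p. u \<in> equilibria K f \<Longrightarrow> p \<in> normal_cone (equilibria K f) u \<Longrightarrow>
      (\<Sum>n. ereal (lam (Suc n) * bet (Suc n)) *
          (fitzpatrick K f u ((2 / bet (Suc n)) *\<^sub>R p)
           - support_fun (equilibria K f) ((2 / bet (Suc n)) *\<^sub>R p))) < \<infinity>"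
    and alpha: "0 \<le> \<alpha>" "\<alpha> < 1 / 3"
    and lam_sum: "(\<Sum>n. ereal (lam (Suc n))) = \<infinity>"
  shows "\<exists>u. bilevel_equilibria K f g = {u} \<and> x \<longlonglongrightarrow> u"
proof -
  let ?S = "equilibria K f"
  obtain u where u: "u \<in> bilevel_equilibria K f g" using S_nonempty by blast
  have uS: "u \<in> ?S" and uK: "u \<in> K" and g_min: "\<And>y. y \<in> ?S \<Longrightarrow> 0 \<le> g u y"
    using u by (auto simp: bilevel_equilibria_def equilibria_def)
  have guu: "g u u = 0" and gu: "convex_on K (g u)" "lsc_on K (g u)"
    using g(3) uK by (auto simp: equilibrium_bifun_def)
  obtain p where p: "p \<in> normal_cone ?S u"
    and mult: "\<And>y. y \<in> K \<Longrightarrow> 0 \<le> g u y + p \<bullet> (y - u)"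
    using Lagrange_multiplier_in_normal_cone[OF K(2) gu closed_convex_equilibria[OF K(2,3) f]
        uK uS _ qualification(2,3)] g_min guu by metis
  \<comment> \<open>The hypothesis on the Fitzpatrick transform is used at \<open>p / 2\<close>, since the factor \<open>2\<close> in it would
    otherwise double the linear term and prevent the cancellation.\<close>
  have half: "(1 / 2) *\<^sub>R p \<in> normal_cone ?S u"
    using p by (auto simp: normal_cone_def split: if_splits)
  obtain e where e: "summable e" "\<And>n. 0 \<le> e n"
    and e_bound: "\<And>n y. y \<in> K \<Longrightarrow>
      lam (Suc n) * bet (Suc n) * f y u \<le> e n - lam (Suc n) * (p \<bullet> (y - u))"
  proof (rule summable_fitzpatrick_error[OF f(3) uK p, of "\<lambda>n. lam (Suc n)" "\<lambda>n. bet (Suc n)"])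
    show "(\<Sum>n. ereal (lam (Suc n) * bet (Suc n)) *
        (fitzpatrick K f u ((1 / bet (Suc n)) *\<^sub>R p) - support_fun ?S ((1 / bet (Suc n)) *\<^sub>R p))) < \<infinity>"
      using fitz[OF uS half] by simp
  qed (use lam_pos bet_pos in auto)
  have "(\<lambda>n. (norm (x n - u))\<^sup>2) \<longlonglongrightarrow> 0"
  proof (rule inertial_energy_tendsto_zero[where \<delta> = "\<lambda>n. (norm (x (Suc n) - x n))\<^sup>2"
        and e = "\<lambda>n. 2 * e n" and l = "\<lambda>n. lam (Suc n)" and c = "2 * \<rho>" and \<alpha> = \<alpha>])
    show "\<not> summable (\<lambda>n. lam (Suc n))" using suminf_ereal_finite lam_sum by blast
    show "summable (\<lambda>n. 2 * e n)" using e(1) by (rule summable_mult)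
    show "0 < 2 * \<rho>" using strong(1) by simp
    show "0 \<le> lam (Suc n)" for n using lam_pos[of "Suc n"] by simp
    fix n
    define y where "y = x (n + 1) + \<alpha> *\<^sub>R (x (n + 1) - x n)"
    let ?z = "x (n + 2)" and ?l = "lam (Suc n)"
    have l: "0 < ?l" using lam_pos by simp
    have "0 \<le> bet (Suc n) * f ?z u + g ?z u + (1 / ?l) * ((?z - y) \<bullet> (u - ?z))"
      using scheme[of "Suc n" u] uK by (simp add: y_def)
    then have "0 \<le> ?l * (bet (Suc n) * f ?z u + g ?z u + (1 / ?l) * ((?z - y) \<bullet> (u - ?z)))"
      using l by simp
    also have "\<dots> = ?l * bet (Suc n) * f ?z u + ?l * g ?z u - (?z - y) \<bullet> (?z - u)"
      using l by (simp add: distrib_left inner_diff_right)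
    finally have 1: "(?z - y) \<bullet> (?z - u) \<le> ?l * bet (Suc n) * f ?z u + ?l * g ?z u" by simp
    have "g ?z u + g u ?z \<le> - \<rho> * (norm (?z - u))\<^sup>2"
      using strong(2) uK x_in[of "n + 2"] by (auto simp: strongly_monotone_bifun_def)
    with mult[OF x_in[of "n + 2"]]
    have "g ?z u \<le> p \<bullet> (?z - u) - \<rho> * (norm (?z - u))\<^sup>2" by simp
    then have "?l * g ?z u \<le> ?l * (p \<bullet> (?z - u) - \<rho> * (norm (?z - u))\<^sup>2)"
      using l by simp
    then have 2: "?l * g ?z u \<le> ?l * (p \<bullet> (?z - u)) - \<rho> * ?l * (norm (?z - u))\<^sup>2"
      by (simp add: algebra_simps)
    \<comment> \<open>The multiplier term from \<open>g\<close> cancels against the one from \<open>f\<close>.\<close>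
    have "(?z - y) \<bullet> (?z - u) \<le> e n - \<rho> * ?l * (norm (?z - u))\<^sup>2"
      using 1 2 e_bound[OF x_in[of "n + 2"], of n] by linarith
    with inertial_step_energy_inequality[OF alpha(1), of ?z u "x (n + 1)" "x n", folded y_def]
    show "(norm (x (n + 2) - u))\<^sup>2 - \<alpha> * (norm (x (n + 1) - u))\<^sup>2
        + (1 - \<alpha>) * (norm (x (Suc (n + 1)) - x (n + 1)))\<^sup>2 + 2 * \<rho> * ?l * (norm (x (n + 2) - u))\<^sup>2
      \<le> (norm (x (n + 1) - u))\<^sup>2 - \<alpha> * (norm (x n - u))\<^sup>2
        + 2 * \<alpha> * (norm (x (Suc n) - x n))\<^sup>2 + 2 * e n"
      by (simp add: algebra_simps)
  qed (use e(2) alpha in auto)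
  then have "(\<lambda>n. norm (x n - u)) \<longlonglongrightarrow> 0"
    using tendsto_real_sqrt[of "\<lambda>n. (norm (x n - u))\<^sup>2" 0] by simp
  then have "x \<longlonglongrightarrow> u" by (simp add: tendsto_norm_zero_iff LIM_zero_iff)
  moreover have "bilevel_equilibria K f g = {u}"
    using u bilevel_equilibria_unique[OF strong u] by blast
  ultimately show ?thesis by blast
qed

end
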